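(* Let $(L,\vee,\wedge,0,1)$ be a non-trivial complete lattice, let $T$ be a non-empty set, let $H,G\colon L^T\to L^T$ be tense operators on $L$ with time set $T$, and let $R$ denote the relation on $T$ induced by $H$ and $G$. Put $\bar T:=T_1\cup T\cup T_2$ where $T_1:=T\times\{1\}$ and $T_2:=T\times\{2\}$, and $$\bar R:=\{\big((s,1),s\big)\mid s\in T\}\cup R\cup\{\big(s,(s,2)\big)\mid s\in T\}\subseteq\bar T\times\bar T,$$ and let $\bar H,\bar G\colon L^{\bar T}\to L^{\bar T}$ denote the tense operators induced by the time frame $(\bar T,\bar R)$. For every $q\in L^T$ let $\bar q\in L^{\bar T}$ be defined by $$\bar q\big((s,1)\big):=H(q)(s),\quad \bar q(s):=q(s),\quad \bar q\big((s,2)\big):=G(q)(s)\quad\text{for all }s\in T.$$ Then $\bar R|T=R$, and $$\big(\bar H(\bar q)\big)|T=H(q)\quad\text{and}\quad\big(\bar G(\bar q)\big)|T=G(q)$$ for all $q\in L^T$.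
   Context: Tense operators on $L$ with time set $T$ (given abstractly, not from a time frame) are arbitrary maps $L^T\to L^T$, where $L^T$ is the set of all functions $T\to L$. Non-trivial means that $L$ has more than one element; $0$ and $1$ are its least and greatest elements. The sets $T_1$, $T$, $T_2$ are regarded as pairwise disjoint. The relation induced by $H$ and $G$ is $\{(s,t)\in T^2\mid H(q)(t)\leq q(s)\text{ and }G(q)(s)\leq q(t)\text{ for all }q\in L^T\}$. A time frame is a pair $(S,Q)$ of a non-empty set $S$ and a non-empty binary relation $Q$ on $S$. The tense operators $H_Q,G_Q\colon L^S\to L^S$ (playing the roles of $H$ and $G$) induced by $(S,Q)$ are defined, for $q\in L^S$ and $s\in S$, by $H_Q(q)(s):=\bigwedge\{q(t)\mid t\mathrel Q s\}$ and $G_Q(q)(s):=\bigwedge\{q(t)\mid s\mathrel Q t\}$, where the meet of the empty set is $1$. Thus $\bar H=H_{\bar R}$ and $\bar G=G_{\bar R}$ for $S=\bar T$. $\bar R|T$ means $\bar R\cap T^2$, and $f|T$ for $f\in L^{\bar T}$ means the restriction of the function $f$ to $T$. *)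

theory Defs
  imports Main
begin

text \<open>
  The lattice \<open>L\<close> is a type \<open>'a\<close> of class \<^class>\<open>complete_lattice\<close> with \<open>0 = bot\<close> and
  \<open>1 = top\<close>. A non-empty time set is a type, and \<open>L\<^sup>T\<close> is the full function type
  \<open>'t \<Rightarrow> 'a\<close>. In this class \<open>Inf {} = top\<close>, as is required of the empty meet.
\<close>

definition induced_rel ::
    "(('t \<Rightarrow> 'a::complete_lattice) \<Rightarrow> 't \<Rightarrow> 'a) \<Rightarrow> (('t \<Rightarrow> 'a) \<Rightarrow> 't \<Rightarrow> 'a) \<Rightarrow> 't rel" where
  "induced_rel H G = {(s, t). \<forall>q. H q t \<le> q s \<and> G q s \<le> q t}"

text \<open>The time set of a frame is the universe of \<open>'s\<close>, hence automatically non-empty.\<close>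

definition time_frame :: "'s rel \<Rightarrow> bool" where
  "time_frame Q \<longleftrightarrow> Q \<noteq> {}"

definition H_of :: "'s rel \<Rightarrow> ('s \<Rightarrow> 'a::complete_lattice) \<Rightarrow> 's \<Rightarrow> 'a" where
  "H_of Q q s = Inf {q t | t. (t, s) \<in> Q}"

definition G_of :: "'s rel \<Rightarrow> ('s \<Rightarrow> 'a::complete_lattice) \<Rightarrow> 's \<Rightarrow> 'a" where
  "G_of Q q s = Inf {q t | t. (s, t) \<in> Q}"

text \<open>
  The disjoint union \<open>T\<^sub>1 \<union> T \<union> T\<^sub>2\<close>: \<open>In1 s\<close> stands for \<open>(s,1)\<close>, \<open>In2 s\<close> for \<open>(s,2)\<close>, and
  \<open>Base\<close> is the inclusion of \<open>T\<close>. Distinctness of the constructors is the disjointness of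
  the three parts.
\<close>

datatype 't ext_time = In1 't | Base 't | In2 't

definition ext_rel :: "'t rel \<Rightarrow> 't ext_time rel" where
  "ext_rel R = {(In1 s, Base s) | s. True} \<union> {(Base s, Base t) | s t. (s, t) \<in> R}
     \<union> {(Base s, In2 s) | s. True}"

lemma time_frame_ext_rel: "time_frame (ext_rel R)"
  by (auto simp: time_frame_def ext_rel_def)

fun ext_fun ::
    "(('t \<Rightarrow> 'a) \<Rightarrow> 't \<Rightarrow> 'a) \<Rightarrow> (('t \<Rightarrow> 'a) \<Rightarrow> 't \<Rightarrow> 'a) \<Rightarrow> ('t \<Rightarrow> 'a) \<Rightarrow> 't ext_time \<Rightarrow> 'a" where
  "ext_fun H G q (In1 s) = H q s"
| "ext_fun H G q (Base s) = q s"
| "ext_fun H G q (In2 s) = G q s"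

text \<open>
  Restriction to \<open>T\<close>, identified with its copy \<open>range Base\<close>: the relation
  \<open>Q \<inter> T\<^sup>2\<close> remains a relation on the extended time set, whereas a restricted function
  is regarded as a function on \<open>'t\<close>.
\<close>

definition rel_restrict :: "'t ext_time rel \<Rightarrow> 't ext_time rel" where
  "rel_restrict Q = Q \<inter> (range Base \<times> range Base)"

definition fun_restrict :: "('t ext_time \<Rightarrow> 'a) \<Rightarrow> 't \<Rightarrow> 'a" where
  "fun_restrict f = (\<lambda>s. f (Base s))"

end

theory Submission
  imports Defs
begin

text \<open>The new point \<open>In1 s\<close> precedes only \<open>Base s\<close> and carries the
  value \<open>H q s\<close>, so the meet defining the extended \<open>H\<close> at
  \<open>Base s\<close> is at most \<open>H q s\<close>. The other predecessors are
  \<open>Base t\<close> with \<open>(t, s)\<close> in \<open>R\<close>, and the induced relation is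
  chosen so that \<open>H q s \<le> q t\<close> there; hence the meet is exactly
  \<open>H q s\<close>. Dually, \<open>In2 s\<close> handles \<open>G\<close>. These are
  \<open>H_of_ext_rel_Base\<close> and \<open>G_of_ext_rel_Base\<close>.\<close>

lemma rel_restrict_ext_rel: "rel_restrict (ext_rel R) = map_prod Base Base ` R"
  by (auto simp: rel_restrict_def ext_rel_def image_iff)

text \<open>The meet is attained at the predecessor \<open>In1 s\<close>. \<open>R\<close> is
  arbitrary here: only the \<open>H\<close> half of the induced relation, at this \<open>q\<close>
  and \<open>s\<close>, is assumed.\<close>

lemma H_of_ext_rel_Base:
  assumes "\<And>t. (t, s) \<in> R \<Longrightarrow> H q s \<le> q t"
  shows "H_of (ext_rel R) (ext_fun H G q) (Base s) = H q s"
  unfolding H_of_def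
proof (rule antisym)
  show "Inf {ext_fun H G q x | x. (x, Base s) \<in> ext_rel R} \<le> H q s"
    by (rule Inf_lower, rule CollectI, rule exI[of _ "In1 s"]) (simp add: ext_rel_def)
  show "H q s \<le> Inf {ext_fun H G q x | x. (x, Base s) \<in> ext_rel R}"
    using assms by (intro Inf_greatest) (auto simp: ext_rel_def)
qed

lemma G_of_ext_rel_Base:
  assumes "\<And>t. (s, t) \<in> R \<Longrightarrow> G q s \<le> q t"
  shows "G_of (ext_rel R) (ext_fun H G q) (Base s) = G q s"
  unfolding G_of_def
proof (rule antisym)
  show "Inf {ext_fun H G q x | x. (Base s, x) \<in> ext_rel R} \<le> G q s"
    by (rule Inf_lower, rule CollectI, rule exI[of _ "In2 s"]) (simp add: ext_rel_def)
  show "G q s \<le> Inf {ext_fun H G q x | x. (Base s, x) \<in> ext_rel R}"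
    \<comment> \<open>The successors of \<open>Base s\<close> are \<open>In2 s\<close>, where
      equality holds, and \<open>Base t\<close> with \<open>(s, t)\<close> in \<open>R\<close>,
      covered by the assumption.\<close>
    using assms by (intro Inf_greatest) (auto simp: ext_rel_def)
qed

theorem theorem5p9:
  fixes H G :: "('t \<Rightarrow> 'a::complete_lattice) \<Rightarrow> ('t \<Rightarrow> 'a)"
    and R :: "'t rel"
  assumes nontrivial: "\<exists>x y :: 'a. x \<noteq> y"
    and R: "R = induced_rel H G"
  shows "rel_restrict (ext_rel R) = map_prod Base Base ` R \<and>
    (\<forall>q. fun_restrict (H_of (ext_rel R) (ext_fun H G q)) = H q \<and>
         fun_restrict (G_of (ext_rel R) (ext_fun H G q)) = G q)"
  using R by (auto simp: rel_restrict_ext_rel fun_restrict_def induced_rel_def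
      intro!: ext H_of_ext_rel_Base G_of_ext_rel_Base)

end
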